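(* Let $U$ be an associative commutative algebra over $\mathbb{C}$ with two commuting derivations $\partial_1$ and $\partial_2$. Then for any $u_1,\ldots,u_5\in U$, $$s_5(D_{12}(u_1),D_{12}(u_2),D_{12}(u_3),D_{12}(u_4),D_{12}(u_5))=-3\,D_{12}([u_1,u_2,u_3,u_4,u_5]),$$ where $$[u_1,u_2,u_3,u_4,u_5]=\left|\begin{array}{ccccc} \partial_1u_1&\partial_1u_2&\partial_1u_3&\partial_1u_4&\partial_1u_5\\ \partial_2u_1&\partial_2u_2&\partial_2u_3&\partial_2u_4&\partial_2u_5\\ \partial_1^2u_1&\partial_1^2u_2&\partial_1^2u_3&\partial_1^2u_4&\partial_1^2u_5\\ \partial_1\partial_2u_1&\partial_1\partial_2u_2&\partial_1\partial_2u_3&\partial_1\partial_2u_4&\partial_1\partial_2u_5\\ \partial_2^2u_1&\partial_2^2u_2&\partial_2^2u_3&\partial_2^2u_4&\partial_2^2u_5 \end{array}\right|$$ and $D_{12}(u)=\partial_1(u)\partial_2-\partial_2(u)\partial_1$.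
   Context: $\mathrm{Diff}(2)$ is the space of (formal) differential operators $\sum_{\alpha\in\mathbb{Z}_{\ge0}^2}u_\alpha\partial^\alpha$ (finite sums, $u_\alpha\in U$, $\partial^\alpha=\partial_1^{\alpha_1}\partial_2^{\alpha_2}$) with the associative product given by composition of operators written as acting on the right, $X\cdot Y$ meaning "first $X$, then $Y$": $$u\partial^\alpha\cdot v\partial^\beta=\sum_{\gamma}\binom{\beta}{\gamma}\,v\,\partial^{\beta-\gamma}(u)\,\partial^{\alpha+\gamma}.$$ $s_5(X_1,\ldots,X_5)=\sum_{\sigma\in \mathrm{Sym}_5}\mathrm{sign}(\sigma)\,X_{\sigma(1)}\cdot X_{\sigma(2)}\cdot X_{\sigma(3)}\cdot X_{\sigma(4)}\cdot X_{\sigma(5)}$, computed in $\mathrm{Diff}(2)$. *)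

theory Defs
  imports
    "HOL-Library.Poly_Mapping"
    "HOL-Combinatorics.Permutations"
    Complex_Main
begin

(* The class comm_ring does not require a unit, so U is an arbitrary, possibly non-unital,
   associative commutative algebra. *)

locale complex_comm_algebra = vector_space scale
  for scale :: "complex \<Rightarrow> 'a \<Rightarrow> 'a::comm_ring" +
  assumes scale_mult_left: "scale c (x * y) = scale c x * y"

definition derivation :: "(complex \<Rightarrow> 'a \<Rightarrow> 'a) \<Rightarrow> ('a \<Rightarrow> 'a::comm_ring) \<Rightarrow> bool" where
  "derivation scale d \<longleftrightarrow>
     Vector_Spaces.linear scale scale d \<and> (\<forall>x y. d (x * y) = d x * y + x * d y)"

(* Formal differential operators: X stands for the finite sum of the terms
   (lookup X (i, j)) d1^i d2^j.  The multiplication that Poly_Mapping puts on this type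
   (convolution) is not the composition product; the latter is diff_mult below. *)

type_synonym 'a diff2 = "(nat \<times> nat) \<Rightarrow>\<^sub>0 'a"

definition diff_scale ::
  "(complex \<Rightarrow> 'a \<Rightarrow> 'a) \<Rightarrow> complex \<Rightarrow> 'a diff2 \<Rightarrow> ('a::comm_ring) diff2" where
  "diff_scale scale c X = Poly_Mapping.map (scale c) X"

(* Operators act on the right: the product of X and Y is "first X, then Y".  The multi-indices
   are alpha = (a1, a2), beta = (b1, b2), gamma = (g1, g2).  The binomial coefficient acts
   through the scalars because U need not contain the integers. *)

definition monom_mult ::
  "(complex \<Rightarrow> 'a \<Rightarrow> 'a) \<Rightarrow> ('a \<Rightarrow> 'a) \<Rightarrow> ('a \<Rightarrow> 'a) \<Rightarrow>
     nat \<times> nat \<Rightarrow> 'a \<Rightarrow> nat \<times> nat \<Rightarrow> 'a \<Rightarrow> ('a::comm_ring) diff2" where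
  "monom_mult scale d1 d2 = (\<lambda>(a1, a2) u (b1, b2) v.
     \<Sum>g1\<le>b1. \<Sum>g2\<le>b2.
       Poly_Mapping.single (a1 + g1, a2 + g2)
         (scale (of_nat ((b1 choose g1) * (b2 choose g2)))
           (v * (d1 ^^ (b1 - g1)) ((d2 ^^ (b2 - g2)) u))))"

definition diff_mult ::
  "(complex \<Rightarrow> 'a \<Rightarrow> 'a) \<Rightarrow> ('a \<Rightarrow> 'a) \<Rightarrow> ('a \<Rightarrow> 'a) \<Rightarrow>
     'a diff2 \<Rightarrow> 'a diff2 \<Rightarrow> ('a::comm_ring) diff2" where
  "diff_mult scale d1 d2 X Y =
     (\<Sum>\<alpha>\<in>Poly_Mapping.keys X. \<Sum>\<beta>\<in>Poly_Mapping.keys Y.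
        monom_mult scale d1 d2 \<alpha> (Poly_Mapping.lookup X \<alpha>) \<beta> (Poly_Mapping.lookup Y \<beta>))"

(* Families of five objects are functions on nat of which only the values at 1, ..., 5 matter. *)

definition s5 ::
  "(complex \<Rightarrow> 'a \<Rightarrow> 'a) \<Rightarrow> ('a \<Rightarrow> 'a) \<Rightarrow> ('a \<Rightarrow> 'a) \<Rightarrow>
     (nat \<Rightarrow> 'a diff2) \<Rightarrow> ('a::comm_ring) diff2" where
  "s5 scale d1 d2 X =
     (let m = diff_mult scale d1 d2 in
      \<Sum>\<sigma> | \<sigma> permutes {1..5}.
        diff_scale scale (of_int (sign \<sigma>))
          (m (m (m (m (X (\<sigma> 1)) (X (\<sigma> 2))) (X (\<sigma> 3))) (X (\<sigma> 4))) (X (\<sigma> 5))))"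

definition D12 :: "('a \<Rightarrow> 'a) \<Rightarrow> ('a \<Rightarrow> 'a) \<Rightarrow> 'a \<Rightarrow> ('a::comm_ring) diff2" where
  "D12 d1 d2 u = Poly_Mapping.single (0, 1) (d1 u) - Poly_Mapping.single (1, 0) (d2 u)"

(* Leibniz expansion of the determinant, row i and column j in 1, ..., 5.  The library
   determinants need a commutative ring with unit. *)

definition det5 :: "(complex \<Rightarrow> 'a \<Rightarrow> 'a) \<Rightarrow> (nat \<Rightarrow> nat \<Rightarrow> 'a) \<Rightarrow> 'a::comm_ring" where
  "det5 scale M =
     (\<Sum>\<sigma> | \<sigma> permutes {1..5}.
        scale (of_int (sign \<sigma>))
          (M 1 (\<sigma> 1) * M 2 (\<sigma> 2) * M 3 (\<sigma> 3) * M 4 (\<sigma> 4) * M 5 (\<sigma> 5)))"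

definition bracket5 ::
  "(complex \<Rightarrow> 'a \<Rightarrow> 'a) \<Rightarrow> ('a \<Rightarrow> 'a) \<Rightarrow> ('a \<Rightarrow> 'a) \<Rightarrow> (nat \<Rightarrow> 'a) \<Rightarrow> 'a::comm_ring" where
  "bracket5 scale d1 d2 u =
     det5 scale (\<lambda>i j. ([d1, d2, d1 \<circ> d1, d1 \<circ> d2, d2 \<circ> d2] ! (i - 1)) (u j))"

end

theory Submission
  imports Defs
begin

text \<open>
  Write \<open>ham w\<close> for right multiplication by \<open>D12 w\<close> on formal operators. It is the formal
  counterpart of the Hamiltonian vector field of \<open>w\<close>, so the commutator of \<open>ham a\<close> and \<open>ham b\<close> is
  \<open>ham\<close> of the Poisson bracket \<open>\<partial>\<^sub>1a \<partial>\<^sub>2b - \<partial>\<^sub>1b \<partial>\<^sub>2a\<close>. In other words \<open>ham a \<circ> ham b\<close> and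
  \<open>ham (\<partial>\<^sub>1a \<partial>\<^sub>2b)\<close> differ by something symmetric in \<open>a\<close> and \<open>b\<close>, and an alternating sum does not see
  symmetric summands. Applied to two pairs of factors, this replaces the fivefold products in \<open>s\<^sub>5\<close>
  by threefold ones: with \<open>x = \<partial>\<^sub>1v\<^sub>1 \<partial>\<^sub>2v\<^sub>2\<close> and \<open>y = \<partial>\<^sub>1v\<^sub>3 \<partial>\<^sub>2v\<^sub>4\<close> it remains to alternate
  \<open>ham x (ham y (D12 v\<^sub>5))\<close> over the permutations \<open>v\<close> of \<open>u\<close>.

  Expanding the threefold product gives coefficients that are products of a derivative of \<open>x\<close>, one
  of \<open>y\<close> and one of \<open>v\<^sub>5\<close>. Their alternating sums are combinations of determinants with
  rows \<open>\<partial>\<^sup>\<alpha>u\<^sub>1, ..., \<partial>\<^sup>\<alpha>u\<^sub>5\<close> for five multi-indices \<open>\<alpha>\<close>. A determinant with a repeated row is zero. Each factor \<open>D12\<close> contributes one \<open>\<partial>\<^sub>1\<close> and one \<open>\<partial>\<^sub>2\<close>, so rows and operator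
  part together have bidegree \<open>(5, 5)\<close>. The smallest total order of five different nonzero rows is
  \<open>1 + 1 + 2 + 2 + 2 = 8\<close>, attained only by the rows of \<open>\<Delta> = [u\<^sub>1, ..., u\<^sub>5]\<close>, of bidegree \<open>(4, 4)\<close>.
  Hence there is no part of order three, and the part of order two is a multiple of
  \<open>\<Delta> \<partial>\<^sub>1\<partial>\<^sub>2\<close>. Exchanging the two coordinates changes the sign of \<open>D12\<close>, hence of \<open>s\<^sub>5\<close>, but
  fixes \<open>\<Delta> \<partial>\<^sub>1\<partial>\<^sub>2\<close>, so this multiple has to be zero. What is left is of order one, and its
  determinants, of total order 9, are exactly those that occur in \<open>\<partial>\<^sub>1\<Delta>\<close> and \<open>\<partial>\<^sub>2\<Delta>\<close> by the
  Leibniz rule; each is found to occur with coefficient 3 up to sign. The ten identities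
  \<open>alternate_first_first\<close> and \<open>alternate_first_second\<close> carry the computation.
\<close>

section \<open>Alternating sums over the permutations of five arguments\<close>

text \<open>
  The sign acts by negation and not through a scalar, so that the sum makes sense in any abelian
  group, both for elements of the algebra and for formal operators.
\<close>

definition alternate :: "((nat \<Rightarrow> 'c) \<Rightarrow> 'b::ab_group_add) \<Rightarrow> (nat \<Rightarrow> 'c) \<Rightarrow> 'b" where
  "alternate F u =
     (\<Sum>\<sigma> | \<sigma> permutes {1..5}. if evenperm \<sigma> then F (u \<circ> \<sigma>) else - F (u \<circ> \<sigma>))"

lemma alternate_hom:
  assumes "\<And>x y. h (x + y) = h x + h y"
  shows "h (alternate F u) = alternate (\<lambda>v. h (F v)) u"
proof -
  interpret additive h by unfold_locales (rule assms)
  show ?thesis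
    unfolding alternate_def sum by (rule sum.cong) (auto simp: minus)
qed

lemma alternate_add: "alternate (\<lambda>v. F v + G v) u = alternate F u + alternate G u"
  unfolding alternate_def sum.distrib[symmetric] by (rule sum.cong) auto

lemma alternate_diff: "alternate (\<lambda>v. F v - G v) u = alternate F u - alternate G u"
  unfolding alternate_def sum_subtractf[symmetric] by (rule sum.cong) auto

lemma evenperm_comp_transpose:
  assumes "\<sigma> permutes {1..5::nat}" "i \<noteq> j"
  shows "evenperm (\<sigma> \<circ> transpose i j) \<longleftrightarrow> \<not> evenperm \<sigma>"
proof -
  have "permutation \<sigma>"
    using assms(1) by (auto simp: permutation_permutes)
  then show ?thesis
    using assms(2) by (simp add: evenperm_comp permutation_swap_id evenperm_swap)
qed

lemma alternate_transpose:
  assumes "i \<in> {1..5}" "j \<in> {1..5}" "i \<noteq> j"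
  shows "alternate (\<lambda>v. F (v \<circ> transpose i j)) u = - alternate F u"
proof -
  have t: "transpose i j permutes {1..5::nat}"
    using assms by (intro permutes_swap_id)
  let ?G = "\<lambda>\<sigma>. if evenperm \<sigma> then F (u \<circ> \<sigma>) else - F (u \<circ> \<sigma>)"
  have "alternate F u = (\<Sum>\<sigma> | \<sigma> permutes {1..5}. ?G (\<sigma> \<circ> transpose i j))"
    unfolding alternate_def by (rule sum_permutations_compose_right[OF t])
  also have "\<dots> = (\<Sum>\<sigma> | \<sigma> permutes {1..5}.
      - (if evenperm \<sigma> then F (u \<circ> \<sigma> \<circ> transpose i j) else - F (u \<circ> \<sigma> \<circ> transpose i j)))"
    by (rule sum.cong) (auto simp: evenperm_comp_transpose[OF _ assms(3)] o_assoc)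
  finally show ?thesis
    unfolding alternate_def sum_negf by simp
qed

text \<open>
  The antisymmetry above only gives that twice the sum is zero. Matching the even with the odd
  permutations gives the result itself, in a group that may have 2-torsion.
\<close>

lemma alternate_symmetric:
  assumes ij: "i \<in> {1..5}" "j \<in> {1..5}" "i \<noteq> j"
    and sym: "\<And>v. F (v \<circ> transpose i j) = F v"
  shows "alternate F u = 0"
proof -
  let ?P = "{\<sigma>. \<sigma> permutes {1..5::nat}}"
  let ?E = "{\<sigma>\<in>?P. evenperm \<sigma>}" and ?O = "{\<sigma>\<in>?P. \<not> evenperm \<sigma>}"
  have t: "transpose i j permutes {1..5::nat}"
    using ij by (intro permutes_swap_id)
  have "alternate F u = (\<Sum>\<sigma>\<in>?E. F (u \<circ> \<sigma>)) + (\<Sum>\<sigma>\<in>?O. - F (u \<circ> \<sigma>))"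
    unfolding alternate_def
    by (subst sum.If_cases) (simp_all add: finite_permutations Collect_conj_eq Collect_neg_eq)
  also have "(\<Sum>\<sigma>\<in>?O. - F (u \<circ> \<sigma>)) = (\<Sum>\<sigma>\<in>?E. - F (u \<circ> \<sigma>))"
  proof (rule sum.reindex_bij_witness[where i = "\<lambda>\<sigma>. \<sigma> \<circ> transpose i j" and j = "\<lambda>\<sigma>. \<sigma> \<circ> transpose i j"])
  qed (use ij t sym in \<open>auto simp: evenperm_comp_transpose o_assoc[symmetric] intro: permutes_compose\<close>,
       simp_all add: o_assoc sym)
  finally show ?thesis
    unfolding sum_negf add.right_inverse .
qed

lemma alternate_cong_mod_symmetric:
  assumes "i \<in> {1..5}" "j \<in> {1..5}" "i \<noteq> j"
    and "\<And>v. F (v \<circ> transpose i j) - G (v \<circ> transpose i j) = F v - G v"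
  shows "alternate F u = alternate G u"
  using alternate_symmetric[OF assms(1-3), of "\<lambda>v. F v - G v" u] assms(4)
  by (simp add: alternate_diff)

lemma alternate_single:
  "alternate (\<lambda>v. Poly_Mapping.single k (f v)) u = Poly_Mapping.single k (alternate f u)"
  by (rule alternate_hom[symmetric]) (rule single_add)

section \<open>Right multiplication by Hamiltonian operators\<close>

lemma additive_eqI:
  fixes f g :: "(nat \<times> nat \<Rightarrow>\<^sub>0 'a::ab_group_add) \<Rightarrow> 'b::ab_group_add"
  assumes "\<And>X Y. f (X + Y) = f X + f Y" "\<And>X Y. g (X + Y) = g X + g Y"
    and "\<And>i j a. f (Poly_Mapping.single (i, j) a) = g (Poly_Mapping.single (i, j) a)"
  shows "f X = g X"
proof (induction X rule: update_induct)
  case const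
  show ?case using assms(1)[of 0 0] assms(2)[of 0 0] by simp
next
  case (update X k c)
  have "Poly_Mapping.update k c X = X + Poly_Mapping.single k c"
    using update(1)
    by (intro poly_mapping_eqI)
      (auto simp: lookup_update lookup_add lookup_single when_def in_keys_iff)
  then show ?case using update assms by (cases k) simp
qed

locale plane_derivations = complex_comm_algebra scale
  for scale :: "complex \<Rightarrow> 'a \<Rightarrow> 'a::comm_ring" +
  fixes d1 d2 :: "'a \<Rightarrow> 'a"
  assumes derivation_d1: "derivation scale d1"
    and derivation_d2: "derivation scale d2"
    and d1_d2_commute: "d1 (d2 x) = d2 (d1 x)"
begin

lemma d_mult: "d1 (x * y) = d1 x * y + x * d1 y" "d2 (x * y) = d2 x * y + x * d2 y"
  using derivation_d1 derivation_d2 by (auto simp: derivation_def)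

lemma d_add: "d1 (x + y) = d1 x + d1 y" "d2 (x + y) = d2 x + d2 y"
  using derivation_d1 derivation_d2
  by (auto simp: derivation_def Vector_Spaces.linear_def module_hom_def module_hom_axioms_def)

sublocale d1: additive d1 by unfold_locales (rule d_add)
sublocale d2: additive d2 by unfold_locales (rule d_add)

lemma d_pow_add:
  "(d1 ^^ n) (x + y) = (d1 ^^ n) x + (d1 ^^ n) y"
  "(d2 ^^ n) (x + y) = (d2 ^^ n) x + (d2 ^^ n) y"
  by (induction n) (simp_all add: d_add)

lemma monom_mult_add_left:
  "monom_mult scale d1 d2 \<alpha> (a + a') \<beta> b =
     monom_mult scale d1 d2 \<alpha> a \<beta> b + monom_mult scale d1 d2 \<alpha> a' \<beta> b"
  by (cases \<alpha>; cases \<beta>)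
    (simp add: monom_mult_def d_pow_add distrib_left scale_right_distrib single_add sum.distrib)

lemma monom_mult_add_right:
  "monom_mult scale d1 d2 \<alpha> a \<beta> (b + b') =
     monom_mult scale d1 d2 \<alpha> a \<beta> b + monom_mult scale d1 d2 \<alpha> a \<beta> b'"
  by (cases \<alpha>; cases \<beta>)
    (simp add: monom_mult_def distrib_right scale_right_distrib single_add sum.distrib)

lemma monom_mult_zero:
  "monom_mult scale d1 d2 \<alpha> 0 \<beta> b = 0" "monom_mult scale d1 d2 \<alpha> a \<beta> 0 = 0"
  using monom_mult_add_left[of \<alpha> 0 0 \<beta> b] monom_mult_add_right[of \<alpha> a \<beta> 0 0] by simp_all

text \<open>
  Summing over larger sets than the supports makes the summation range independent of the operators,
  which is what additivity of the product requires.
\<close>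

lemma diff_mult_superset:
  assumes "finite A" "Poly_Mapping.keys X \<subseteq> A" "finite B" "Poly_Mapping.keys Y \<subseteq> B"
  shows "diff_mult scale d1 d2 X Y =
    (\<Sum>\<alpha>\<in>A. \<Sum>\<beta>\<in>B. monom_mult scale d1 d2 \<alpha> (Poly_Mapping.lookup X \<alpha>) \<beta> (Poly_Mapping.lookup Y \<beta>))"
proof -
  have "diff_mult scale d1 d2 X Y =
      (\<Sum>\<alpha>\<in>Poly_Mapping.keys X. \<Sum>\<beta>\<in>B.
         monom_mult scale d1 d2 \<alpha> (Poly_Mapping.lookup X \<alpha>) \<beta> (Poly_Mapping.lookup Y \<beta>))"
    unfolding diff_mult_def
    by (intro sum.cong refl sum.mono_neutral_left)
      (use assms in \<open>auto simp: in_keys_iff monom_mult_zero\<close>)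
  also have "\<dots> = (\<Sum>\<alpha>\<in>A. \<Sum>\<beta>\<in>B.
         monom_mult scale d1 d2 \<alpha> (Poly_Mapping.lookup X \<alpha>) \<beta> (Poly_Mapping.lookup Y \<beta>))"
    by (intro sum.mono_neutral_left) (use assms in \<open>auto simp: in_keys_iff monom_mult_zero\<close>)
  finally show ?thesis .
qed

lemma diff_mult_add_left:
  "diff_mult scale d1 d2 (X + X') Y = diff_mult scale d1 d2 X Y + diff_mult scale d1 d2 X' Y"
  using keys_add[of X X']
  by (simp add: diff_mult_superset[where A = "Poly_Mapping.keys X \<union> Poly_Mapping.keys X'"
        and B = "Poly_Mapping.keys Y"] lookup_add monom_mult_add_left sum.distrib)

lemma diff_mult_add_right:
  "diff_mult scale d1 d2 X (Y + Y') = diff_mult scale d1 d2 X Y + diff_mult scale d1 d2 X Y'"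
  using keys_add[of Y Y']
  by (simp add: diff_mult_superset[where A = "Poly_Mapping.keys X"
        and B = "Poly_Mapping.keys Y \<union> Poly_Mapping.keys Y'"]
      lookup_add monom_mult_add_right sum.distrib)

lemma diff_mult_single:
  "diff_mult scale d1 d2 (Poly_Mapping.single \<alpha> a) (Poly_Mapping.single \<beta> b) =
     monom_mult scale d1 d2 \<alpha> a \<beta> b"
  by (simp add: diff_mult_superset[where A = "{\<alpha>}" and B = "{\<beta>}"])

definition ham :: "'a \<Rightarrow> 'a diff2 \<Rightarrow> 'a diff2" where
  "ham w X = diff_mult scale d1 d2 X (D12 d1 d2 w)"

lemma ham_add: "ham w (X + Y) = ham w X + ham w Y"
  by (simp add: ham_def diff_mult_add_left)

sublocale ham: additive "ham w" for w by unfold_locales (rule ham_add)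

lemma ham_single:
  "ham w (Poly_Mapping.single (i, j) a) =
     Poly_Mapping.single (i, j) (d1 w * d2 a - d2 w * d1 a)
     + Poly_Mapping.single (i, Suc j) (d1 w * a) - Poly_Mapping.single (Suc i, j) (d2 w * a)"
proof -
  have D: "D12 d1 d2 w = Poly_Mapping.single (0, 1) (d1 w) + Poly_Mapping.single (1, 0) (- d2 w)"
    by (simp add: D12_def single_uminus)
  show ?thesis
    unfolding ham_def D diff_mult_add_right diff_mult_single
    by (simp add: monom_mult_def atMost_Suc single_uminus single_diff algebra_simps)
qed

lemma ham_diff_left: "ham (a - b) X = ham a X - ham b X"
  by (rule additive_eqI[where f = "ham (a - b)" and g = "\<lambda>X. ham a X - ham b X"])
    (simp_all add: ham_add ham_single d1.diff d2.diff algebra_simps single_add single_diff)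

text \<open>
  Both sides are additive in \<open>X\<close>, so it is enough to compare them on a single term. There, the
  terms in which neither factor differentiates the coefficients of the other are symmetric in \<open>a\<close>
  and \<open>b\<close>, and the remaining ones make up the Poisson bracket by the product rule.
\<close>

lemma ham_commutator:
  "ham a (ham b X) - ham b (ham a X) = ham (d1 a * d2 b - d1 b * d2 a) X"
proof (rule additive_eqI[where f = "\<lambda>X. ham a (ham b X) - ham b (ham a X)"
      and g = "ham (d1 a * d2 b - d1 b * d2 a)"])
  fix i j c
  show "ham a (ham b (Poly_Mapping.single (i, j) c)) - ham b (ham a (Poly_Mapping.single (i, j) c)) =
      ham (d1 a * d2 b - d1 b * d2 a) (Poly_Mapping.single (i, j) c)"
    by (simp add: ham_single ham_add ham.diff d1.diff d2.diff d_mult d_add d1_d2_commute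
        algebra_simps single_add single_diff)
qed (simp_all add: ham_add)

text \<open>
  By the commutator formula, \<open>ham a \<circ> ham b - ham (\<partial>\<^sub>1a \<partial>\<^sub>2b)\<close> is symmetric in \<open>a\<close> and \<open>b\<close>. The
  context \<open>H\<close> and the operand \<open>G\<close> may depend on the other three arguments.
\<close>

lemma alternate_ham_ham:
  assumes ij: "i \<in> {1..5}" "j \<in> {1..5}" "i \<noteq> j"
    and G: "\<And>v. G (v \<circ> transpose i j) = G v"
    and H: "\<And>v. H (v \<circ> transpose i j) = H v" "\<And>v. additive (H v)"
  shows "alternate (\<lambda>v. H v (ham (v i) (ham (v j) (G v)))) u =
     alternate (\<lambda>v. H v (ham (d1 (v i) * d2 (v j)) (G v))) u"
proof (rule alternate_cong_mod_symmetric[OF ij])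
  fix v
  have "ham (v i) (ham (v j) (G v)) - ham (d1 (v i) * d2 (v j)) (G v) =
        ham (v j) (ham (v i) (G v)) - ham (d1 (v j) * d2 (v i)) (G v)"
    using ham_commutator[of "v i" "v j" "G v"] by (simp add: ham_diff_left algebra_simps)
  then show "H (v \<circ> transpose i j)
          (ham ((v \<circ> transpose i j) i) (ham ((v \<circ> transpose i j) j) (G (v \<circ> transpose i j)))) -
         H (v \<circ> transpose i j)
          (ham (d1 ((v \<circ> transpose i j) i) * d2 ((v \<circ> transpose i j) j)) (G (v \<circ> transpose i j))) =
         H v (ham (v i) (ham (v j) (G v))) - H v (ham (d1 (v i) * d2 (v j)) (G v))"
    using additive.diff[OF H(2), symmetric] by (simp add: G H(1))
qed

section \<open>Determinants of partial derivatives\<close>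

definition jet :: "nat \<times> nat \<Rightarrow> 'a \<Rightarrow> 'a" where
  "jet = (\<lambda>(i, j) a. (d1 ^^ i) ((d2 ^^ j) a))"

lemma d1_jet: "d1 (jet (i, j) a) = jet (Suc i, j) a"
  by (simp add: jet_def)

lemma d2_d1_pow: "d2 ((d1 ^^ i) a) = (d1 ^^ i) (d2 a)"
  by (induction i) (simp_all add: d1_d2_commute[symmetric])

lemma d2_jet: "d2 (jet (i, j) a) = jet (i, Suc j) a"
  by (simp add: jet_def d2_d1_pow)

lemma d_eq_jet: "d1 = jet (1, 0)" "d2 = jet (0, 1)"
  by (auto simp: jet_def)

lemma D12_jet:
  "D12 d1 d2 a = Poly_Mapping.single (0, 1) (jet (1, 0) a) - Poly_Mapping.single (1, 0) (jet (0, 1) a)"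
  by (simp add: D12_def jet_def)

text \<open>
  The \<open>5 \<times> 5\<close> determinant with rows \<open>jet \<alpha>\<close>, ..., \<open>jet \<epsilon>\<close> and columns \<open>u 1\<close>, ..., \<open>u 5\<close>. The
  product is bracketed to the right, the form that \<open>mult.assoc\<close> produces.
\<close>

definition jet_det ::
  "(nat \<Rightarrow> 'a) \<Rightarrow> nat \<times> nat \<Rightarrow> nat \<times> nat \<Rightarrow> nat \<times> nat \<Rightarrow> nat \<times> nat \<Rightarrow> nat \<times> nat \<Rightarrow> 'a" where
  "jet_det u \<alpha> \<beta> \<gamma> \<delta> \<epsilon> =
     alternate (\<lambda>v. jet \<alpha> (v 1) * (jet \<beta> (v 2) * (jet \<gamma> (v 3) * (jet \<delta> (v 4) * jet \<epsilon> (v 5))))) u"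

lemma jet_det_swap:
  "jet_det u \<beta> \<alpha> \<gamma> \<delta> \<epsilon> = - jet_det u \<alpha> \<beta> \<gamma> \<delta> \<epsilon>"
  "jet_det u \<alpha> \<gamma> \<beta> \<delta> \<epsilon> = - jet_det u \<alpha> \<beta> \<gamma> \<delta> \<epsilon>"
  "jet_det u \<alpha> \<beta> \<delta> \<gamma> \<epsilon> = - jet_det u \<alpha> \<beta> \<gamma> \<delta> \<epsilon>"
  "jet_det u \<alpha> \<beta> \<gamma> \<epsilon> \<delta> = - jet_det u \<alpha> \<beta> \<gamma> \<delta> \<epsilon>"
proof -
  let ?F = "\<lambda>v. jet \<alpha> (v 1) * (jet \<beta> (v 2) * (jet \<gamma> (v 3) * (jet \<delta> (v 4) * jet \<epsilon> (v 5))))"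
  show "jet_det u \<beta> \<alpha> \<gamma> \<delta> \<epsilon> = - jet_det u \<alpha> \<beta> \<gamma> \<delta> \<epsilon>"
    using alternate_transpose[of 1 2 ?F u] by (simp add: jet_det_def transpose_def mult.left_commute)
  show "jet_det u \<alpha> \<gamma> \<beta> \<delta> \<epsilon> = - jet_det u \<alpha> \<beta> \<gamma> \<delta> \<epsilon>"
    using alternate_transpose[of 2 3 ?F u] by (simp add: jet_det_def transpose_def mult.left_commute)
  show "jet_det u \<alpha> \<beta> \<delta> \<gamma> \<epsilon> = - jet_det u \<alpha> \<beta> \<gamma> \<delta> \<epsilon>"
    using alternate_transpose[of 3 4 ?F u] by (simp add: jet_det_def transpose_def mult.left_commute)
  show "jet_det u \<alpha> \<beta> \<gamma> \<epsilon> \<delta> = - jet_det u \<alpha> \<beta> \<gamma> \<delta> \<epsilon>"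
    using alternate_transpose[of 4 5 ?F u] by (simp add: jet_det_def transpose_def mult.commute)
qed

lemma jet_det_repeat:
  "jet_det u \<alpha> \<alpha> \<gamma> \<delta> \<epsilon> = 0" "jet_det u \<alpha> \<beta> \<beta> \<delta> \<epsilon> = 0"
  "jet_det u \<alpha> \<beta> \<gamma> \<gamma> \<epsilon> = 0" "jet_det u \<alpha> \<beta> \<gamma> \<delta> \<delta> = 0"
  unfolding jet_det_def
  by (rule alternate_symmetric[of 1 2] alternate_symmetric[of 2 3] alternate_symmetric[of 3 4]
      alternate_symmetric[of 4 5]; simp add: transpose_def mult_ac)+

text \<open>
  The order of the rows in the determinant \<open>\<Delta>\<close>: by total order of differentiation, then with more
  \<open>\<partial>\<^sub>1\<close> first. With this side condition the antisymmetry rules are terminating rewrite rules that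
  sort the rows, and after sorting, repeated rows are adjacent.
\<close>

fun precedes :: "nat \<times> nat \<Rightarrow> nat \<times> nat \<Rightarrow> bool" where
  "precedes (i, j) (k, l) \<longleftrightarrow> i + j < k + l \<or> i + j = k + l \<and> k < i"

lemma jet_det_sort:
  "precedes \<alpha> \<beta> \<Longrightarrow> jet_det u \<beta> \<alpha> \<gamma> \<delta> \<epsilon> = - jet_det u \<alpha> \<beta> \<gamma> \<delta> \<epsilon>"
  "precedes \<beta> \<gamma> \<Longrightarrow> jet_det u \<alpha> \<gamma> \<beta> \<delta> \<epsilon> = - jet_det u \<alpha> \<beta> \<gamma> \<delta> \<epsilon>"
  "precedes \<gamma> \<delta> \<Longrightarrow> jet_det u \<alpha> \<beta> \<delta> \<gamma> \<epsilon> = - jet_det u \<alpha> \<beta> \<gamma> \<delta> \<epsilon>"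
  "precedes \<delta> \<epsilon> \<Longrightarrow> jet_det u \<alpha> \<beta> \<gamma> \<epsilon> \<delta> = - jet_det u \<alpha> \<beta> \<gamma> \<delta> \<epsilon>"
  by (rule jet_det_swap)+

lemma d_jet_det:
  "d1 (jet_det u (i1,j1) (i2,j2) (i3,j3) (i4,j4) (i5,j5)) =
     jet_det u (Suc i1,j1) (i2,j2) (i3,j3) (i4,j4) (i5,j5)
     + jet_det u (i1,j1) (Suc i2,j2) (i3,j3) (i4,j4) (i5,j5)
     + jet_det u (i1,j1) (i2,j2) (Suc i3,j3) (i4,j4) (i5,j5)
     + jet_det u (i1,j1) (i2,j2) (i3,j3) (Suc i4,j4) (i5,j5)
     + jet_det u (i1,j1) (i2,j2) (i3,j3) (i4,j4) (Suc i5,j5)"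
  "d2 (jet_det u (i1,j1) (i2,j2) (i3,j3) (i4,j4) (i5,j5)) =
     jet_det u (i1,Suc j1) (i2,j2) (i3,j3) (i4,j4) (i5,j5)
     + jet_det u (i1,j1) (i2,Suc j2) (i3,j3) (i4,j4) (i5,j5)
     + jet_det u (i1,j1) (i2,j2) (i3,Suc j3) (i4,j4) (i5,j5)
     + jet_det u (i1,j1) (i2,j2) (i3,j3) (i4,Suc j4) (i5,j5)
     + jet_det u (i1,j1) (i2,j2) (i3,j3) (i4,j4) (i5,Suc j5)"
  unfolding jet_det_def
  by (simp_all add: alternate_hom[of d1, OF d_add(1)] alternate_hom[of d2, OF d_add(2)]
      alternate_add[symmetric] d_mult d1_jet d2_jet algebra_simps)

lemma bracket5_eq_jet_det:
  "bracket5 scale d1 d2 u = jet_det u (1,0) (0,1) (2,0) (1,1) (0,2)"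
  by (simp add: bracket5_def det5_def jet_det_def alternate_def jet_def sign_def mult.assoc
      eval_nat_numeral if_distrib[of "\<lambda>c. scale (of_int c) _"] cong: if_cong)

section \<open>The alternating sum of the threefold products\<close>

context
  fixes x y :: "(nat \<Rightarrow> 'a) \<Rightarrow> 'a"
  defines "x \<equiv> \<lambda>v. jet (1, 0) (v 1) * jet (0, 1) (v 2)"
    and "y \<equiv> \<lambda>v. jet (1, 0) (v 3) * jet (0, 1) (v 4)"
begin

text \<open>
  These and the next identities are computations in an exterior algebra. Let \<open>p, q\<close> stand for the
  rows of first derivatives and \<open>r, s, t\<close> for those of second derivatives. Then \<open>x\<close> and \<open>y\<close> become
  \<open>pq\<close>, with derivatives \<open>\<partial>\<^sub>1(pq) = rq + ps\<close> and \<open>\<partial>\<^sub>2(pq) = sq + pt\<close>. For instance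
  \<open>(rq + ps)(rq + ps) = rqps + psrq = -2 pqrs\<close>, which is the first identity.
\<close>

lemma alternate_first_first:
  "alternate (\<lambda>v. d1 (x v) * (d1 (y v) * jet \<epsilon> (v 5))) u =
     - jet_det u (1,0) (0,1) (2,0) (1,1) \<epsilon> - jet_det u (1,0) (0,1) (2,0) (1,1) \<epsilon>"
  "alternate (\<lambda>v. d1 (x v) * (d2 (y v) * jet \<epsilon> (v 5))) u =
     - jet_det u (1,0) (0,1) (2,0) (0,2) \<epsilon>"
  "alternate (\<lambda>v. d2 (x v) * (d1 (y v) * jet \<epsilon> (v 5))) u =
     - jet_det u (1,0) (0,1) (2,0) (0,2) \<epsilon>"
  "alternate (\<lambda>v. d2 (x v) * (d2 (y v) * jet \<epsilon> (v 5))) u =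
     - jet_det u (1,0) (0,1) (1,1) (0,2) \<epsilon> - jet_det u (1,0) (0,1) (1,1) (0,2) \<epsilon>"
  by (simp_all add: x_def y_def d_mult d_add d1_jet d2_jet distrib_left distrib_right mult.assoc
      alternate_add jet_det_def[symmetric, unfolded One_nat_def])
    (simp_all add: jet_det_repeat jet_det_sort numeral_2_eq_2 numeral_3_eq_3)

text \<open>
  Here \<open>\<partial>\<^sub>1\<^sup>2(pq) = (\<partial>\<^sub>1r) q + 2rs + p (\<partial>\<^sub>1s)\<close> and similarly for the other second derivatives. The
  terms with a third derivative keep both \<open>p\<close> and \<open>q\<close>, the others keep one of them next to \<open>rst\<close>.
\<close>

lemma alternate_first_second:
  "alternate (\<lambda>v. d1 (x v) * (d1 (d1 (y v)) * jet \<epsilon> (v 5))) u =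
     jet_det u (1,0) (0,1) (1,1) (3,0) \<epsilon> - jet_det u (1,0) (0,1) (2,0) (2,1) \<epsilon>"
  "alternate (\<lambda>v. d1 (x v) * (d2 (d1 (y v)) * jet \<epsilon> (v 5))) u =
     jet_det u (1,0) (0,1) (1,1) (2,1) \<epsilon> - jet_det u (1,0) (0,1) (2,0) (1,2) \<epsilon>
     - jet_det u (1,0) (2,0) (1,1) (0,2) \<epsilon>"
  "alternate (\<lambda>v. d1 (x v) * (d2 (d2 (y v)) * jet \<epsilon> (v 5))) u =
     jet_det u (1,0) (0,1) (1,1) (1,2) \<epsilon> - jet_det u (1,0) (0,1) (2,0) (0,3) \<epsilon>
     - jet_det u (0,1) (2,0) (1,1) (0,2) \<epsilon> - jet_det u (0,1) (2,0) (1,1) (0,2) \<epsilon>"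
  "alternate (\<lambda>v. d2 (x v) * (d1 (d1 (y v)) * jet \<epsilon> (v 5))) u =
     jet_det u (1,0) (0,1) (0,2) (3,0) \<epsilon> - jet_det u (1,0) (0,1) (1,1) (2,1) \<epsilon>
     + jet_det u (1,0) (2,0) (1,1) (0,2) \<epsilon> + jet_det u (1,0) (2,0) (1,1) (0,2) \<epsilon>"
  "alternate (\<lambda>v. d2 (x v) * (d2 (d1 (y v)) * jet \<epsilon> (v 5))) u =
     jet_det u (1,0) (0,1) (0,2) (2,1) \<epsilon> - jet_det u (1,0) (0,1) (1,1) (1,2) \<epsilon>
     + jet_det u (0,1) (2,0) (1,1) (0,2) \<epsilon>"
  "alternate (\<lambda>v. d2 (x v) * (d2 (d2 (y v)) * jet \<epsilon> (v 5))) u =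
     jet_det u (1,0) (0,1) (0,2) (1,2) \<epsilon> - jet_det u (1,0) (0,1) (1,1) (0,3) \<epsilon>"
  by (simp_all add: x_def y_def d_mult d_add d1_jet d2_jet distrib_left distrib_right mult.assoc
      alternate_add jet_det_def[symmetric, unfolded One_nat_def])
    (simp_all add: jet_det_repeat jet_det_sort numeral_2_eq_2 numeral_3_eq_3)

lemma alternate_ham_ham_D12:
  assumes "D = D12 d1 d2 (jet_det u (1,0) (0,1) (2,0) (1,1) (0,2))"
  shows "alternate (\<lambda>v. ham (x v) (ham (y v) (D12 d1 d2 (v 5)))) u = - (D + D + D)"
  unfolding assms
  \<comment> \<open>Only the innermost operator is rewritten with jets, so that \<open>x\<close> and \<open>y\<close> stay folded and each
      coefficient matches one of the ten identities.\<close>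
  apply (simp add: D12_jet[of "v 5" for v] ham_single ham_add ham.diff d1.diff d2.diff d_mult d_add
      d1_d2_commute distrib_left right_diff_distrib mult.assoc d1_jet d2_jet
      alternate_add alternate_diff alternate_single)
  apply (simp add: alternate_first_first alternate_first_second single_add single_diff single_uminus
      jet_det_sort jet_det_repeat)
  \<comment> \<open>Once all rows are sorted, the parts of order three and two cancel, and the part of order one
      is compared with the Leibniz expansion of the derivatives of the determinant.\<close>
  apply (simp add: d_jet_det D12_def jet_det_sort jet_det_repeat numeral_2_eq_2 numeral_3_eq_3
      single_add single_diff algebra_simps)
  done

end

section \<open>The standard polynomial\<close>

lemma diff_scale_sign:
  "diff_scale scale (of_int (sign \<sigma>)) X = (if evenperm \<sigma> then X else - X)"
  by (intro poly_mapping_eqI) (simp add: diff_scale_def map.rep_eq sign_def when_def)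

text \<open>
  In a product of operators acting on the right, the last factor is the outermost \<open>ham\<close>. The
  arguments can nevertheless be numbered from the outside in, because the reversal of five letters
  is an even permutation.
\<close>

lemma s5_eq_alternate:
  "s5 scale d1 d2 (\<lambda>i. D12 d1 d2 (u i)) =
     alternate (\<lambda>v. ham (v 1) (ham (v 2) (ham (v 3) (ham (v 4) (D12 d1 d2 (v 5)))))) u"
proof -
  let ?F = "\<lambda>v. ham (v 1) (ham (v 2) (ham (v 3) (ham (v 4) (D12 d1 d2 (v 5)))))"
  have "s5 scale d1 d2 (\<lambda>i. D12 d1 d2 (u i)) =
      alternate (\<lambda>v. ?F (v \<circ> transpose 2 4 \<circ> transpose 1 5)) u"
    by (simp add: s5_def alternate_def ham_def diff_scale_sign transpose_def Let_def cong: if_cong)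
  then show ?thesis
    using alternate_transpose[of 2 4 "\<lambda>v. ?F (v \<circ> transpose 1 5)" u]
      alternate_transpose[of 1 5 ?F u] by (simp add: o_assoc)
qed

lemma diff_scale_minus_three: "diff_scale scale (- 3) X = - (X + X + X)"
proof (intro poly_mapping_eqI)
  fix k
  have "scale (- 3) c = - (c + c + c)" for c
    using scale_left_distrib[of 1 1 c] scale_left_distrib[of 2 1 c] by simp
  then show "Poly_Mapping.lookup (diff_scale scale (- 3) X) k = Poly_Mapping.lookup (- (X + X + X)) k"
    by (simp add: diff_scale_def map.rep_eq lookup_minus when_def)
qed

lemma s5_D12:
  "s5 scale d1 d2 (\<lambda>i. D12 d1 d2 (u i)) =
     diff_scale scale (- 3) (D12 d1 d2 (bracket5 scale d1 d2 u))"
proof -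
  have "s5 scale d1 d2 (\<lambda>i. D12 d1 d2 (u i)) =
     alternate (\<lambda>v. ham (d1 (v 1) * d2 (v 2)) (ham (v 3) (ham (v 4) (D12 d1 d2 (v 5))))) u"
    unfolding s5_eq_alternate
    by (rule alternate_ham_ham[where H = "\<lambda>_ X. X"]) (auto simp: additive_def transpose_def)
  also have "\<dots> =
      alternate (\<lambda>v. ham (d1 (v 1) * d2 (v 2)) (ham (d1 (v 3) * d2 (v 4)) (D12 d1 d2 (v 5)))) u"
    by (rule alternate_ham_ham[where G = "\<lambda>v. D12 d1 d2 (v 5)"])
      (auto simp: transpose_def intro: ham.additive_axioms)
  also have "\<dots> = diff_scale scale (- 3) (D12 d1 d2 (bracket5 scale d1 d2 u))"
    unfolding diff_scale_minus_three
    by (rule alternate_ham_ham_D12[folded d_eq_jet]) (simp only: bracket5_eq_jet_det)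
  finally show ?thesis .
qed

end

theorem theorem9p1:
  fixes scale :: "complex \<Rightarrow> 'a::comm_ring \<Rightarrow> 'a"
    and d1 d2 :: "'a \<Rightarrow> 'a"
    and u :: "nat \<Rightarrow> 'a"
  assumes "complex_comm_algebra scale"
    and "derivation scale d1"
    and "derivation scale d2"
    and "\<And>x. d1 (d2 x) = d2 (d1 x)"
  shows "s5 scale d1 d2 (\<lambda>i. D12 d1 d2 (u i)) =
           diff_scale scale (- 3) (D12 d1 d2 (bracket5 scale d1 d2 u))"
proof -
  interpret plane_derivations scale d1 d2
    using assms by (intro plane_derivations.intro plane_derivations_axioms.intro)
  show ?thesis by (rule s5_D12)
qed

end
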